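(* Let $K$ be a field of characteristic $0$, $q\in K^*$, $n\ge 2$, and let $D_q(n)$ be the Dipper–Donkin quantized matrix algebra with generators $d_{ij}$, $1\le i,j\le n$. Then $D_q(n)$ has the $K$-linear basis (PBW basis) $$\mathcal B=\left\{ d_{11}^{k_{11}}d_{12}^{k_{12}}\cdots d_{1n}^{k_{1n}}d_{21}^{k_{21}}\cdots d_{2n}^{k_{2n}}\cdots d_{n1}^{k_{n1}}\cdots d_{nn}^{k_{nn}}\ \middle|\ k_{ij}\in\mathbb N,\ 1\le i,j\le n\right\}.$$
   Context: $\mathbb N$ includes $0$; $K^*=K\setminus\{0\}$. $D_q(n)$ is the associative unital $K$-algebra generated by $d_{ij}$ ($1\le i,j\le n$) subject to the relations: $d_{ij}d_{st}=qd_{st}d_{ij}$ if $i>s$ and $j\le t$; $d_{ij}d_{st}=d_{st}d_{ij}+(q-1)d_{sj}d_{it}$ if $i>s$ and $j>t$; $d_{ij}d_{ik}=d_{ik}d_{ij}$ for all $i,j,k$. *)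

theory Defs
  imports
    "HOL-Algebra.QuotRing"
    "HOL-Library.FuncSet"
    "HOL-Library.Poly_Mapping"
    "Jordan_Normal_Form.VS_Connect"
begin

text \<open>
  The free monoid is written additively, because the convolution product on
  \<^typ>\<open>'a \<Rightarrow>\<^sub>0 'b\<close> (which makes it the monoid algebra of \<^typ>\<open>'a\<close> over \<^typ>\<open>'b\<close>) is
  available for \<^class>\<open>monoid_add\<close>.
\<close>

datatype 'x free_monoid = Word (letters: "'x list")

instantiation free_monoid :: (type) monoid_add
begin

definition "0 = Word []"
definition "u + v = Word (letters u @ letters v)"

instance
  by standard (simp_all add: zero_free_monoid_def plus_free_monoid_def)

end

lemma letters_zero [simp]: "letters 0 = []"
  by (simp add: zero_free_monoid_def)

lemma letters_plus [simp]: "letters (u + v) = letters u @ letters v"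
  by (simp add: plus_free_monoid_def)

text \<open>
  The free associative unital algebra on the set \<open>X\<close> of noncommuting variables: the finitely
  supported combinations of words with letters in \<open>X\<close>. The element
  \<open>Poly_Mapping.single 0 c\<close> is the scalar \<open>c\<close> times the unit.
\<close>

definition free_algebra :: "'x set \<Rightarrow> ('k::field, 'x free_monoid \<Rightarrow>\<^sub>0 'k) module" where
  "free_algebra X =
     \<lparr>carrier = {f. \<forall>w \<in> Poly_Mapping.keys f. set (letters w) \<subseteq> X},
      mult = (*), one = 1, zero = 0, add = (+),
      smult = (\<lambda>c f. Poly_Mapping.single 0 c * f)\<rparr>"

definition free_gen :: "'x \<Rightarrow> ('x free_monoid \<Rightarrow>\<^sub>0 'k::field)" where
  "free_gen x = Poly_Mapping.single (Word [x]) 1"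

text \<open>
  The quotient of an algebra by a two-sided ideal; a scalar acts on a coset through
  representatives (the union does not depend on the representative).
\<close>

definition quotient_algebra :: "('k, 'a) module \<Rightarrow> 'a set \<Rightarrow> ('k, 'a set) module" where
  "quotient_algebra A I =
     ring.extend (A Quot I)
       (module.fields (\<lambda>c C. \<Union>f\<in>C. I +>\<^bsub>A\<^esub> (c \<odot>\<^bsub>A\<^esub> f)))"

abbreviation dd_index :: "nat \<Rightarrow> (nat \<times> nat) set" where
  "dd_index n \<equiv> {1..n} \<times> {1..n}"

text \<open>Each element \<open>l - r\<close> stands for the defining relation \<open>l = r\<close>.\<close>

definition dd_relations :: "'k::field \<Rightarrow> nat \<Rightarrow> ((nat \<times> nat) free_monoid \<Rightarrow>\<^sub>0 'k) set" where
  "dd_relations q n =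
     (let d = (\<lambda>i j. free_gen (i, j)); const = Poly_Mapping.single 0 in
      {d i j * d s t - const q * (d s t * d i j) | i j s t.
         (i, j) \<in> dd_index n \<and> (s, t) \<in> dd_index n \<and> i > s \<and> j \<le> t} \<union>
      {d i j * d s t - (d s t * d i j + const (q - 1) * (d s j * d i t)) | i j s t.
         (i, j) \<in> dd_index n \<and> (s, t) \<in> dd_index n \<and> i > s \<and> j > t} \<union>
      {d i j * d i k - d i k * d i j | i j k.
         (i, j) \<in> dd_index n \<and> (i, k) \<in> dd_index n})"

definition dd_ideal :: "'k::field \<Rightarrow> nat \<Rightarrow> ((nat \<times> nat) free_monoid \<Rightarrow>\<^sub>0 'k) set" where
  "dd_ideal q n = Idl\<^bsub>free_algebra (dd_index n) :: ('k, _) module\<^esub> (dd_relations q n)"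

definition dd_algebra ::
    "'k::field \<Rightarrow> nat \<Rightarrow> ('k, ((nat \<times> nat) free_monoid \<Rightarrow>\<^sub>0 'k) set) module" where
  "dd_algebra q n = quotient_algebra (free_algebra (dd_index n)) (dd_ideal q n)"

definition dd_gen ::
    "'k::field \<Rightarrow> nat \<Rightarrow> nat \<times> nat \<Rightarrow> ((nat \<times> nat) free_monoid \<Rightarrow>\<^sub>0 'k) set" where
  "dd_gen q n x =
     dd_ideal q n +>\<^bsub>free_algebra (dd_index n) :: ('k, _) module\<^esub> free_gen x"

text \<open>
  \<^const>\<open>List.product\<close> enumerates the index pairs row by row, so this is the product of the
  powers of \<open>d\<^sub>1\<^sub>1, d\<^sub>1\<^sub>2, \<dots>, d\<^sub>1\<^sub>n, d\<^sub>2\<^sub>1, \<dots>, d\<^sub>n\<^sub>n\<close> in that order.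
\<close>

definition dd_monomial ::
    "'k::field \<Rightarrow> nat \<Rightarrow> (nat \<times> nat \<Rightarrow> nat) \<Rightarrow> ((nat \<times> nat) free_monoid \<Rightarrow>\<^sub>0 'k) set" where
  "dd_monomial q n k =
     foldr (\<lambda>x m. (dd_gen q n x [^]\<^bsub>dd_algebra q n\<^esub> k x) \<otimes>\<^bsub>dd_algebra q n\<^esub> m)
       (List.product [1..<Suc n] [1..<Suc n]) \<one>\<^bsub>dd_algebra q n\<^esub>"


text \<open>
  The notions of linear algebra used for \<^const>\<open>dd_algebra\<close> live in the locale
  \<^locale>\<open>vectorspace\<close>; the following facts show that it applies.
\<close>

lemma free_algebra_simps:
  "mult (free_algebra X) = (*)" "one (free_algebra X) = 1"
  "zero (free_algebra X) = 0" "add (free_algebra X) = (+)"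
  "smult (free_algebra X) c f = Poly_Mapping.single 0 c * f"
  by (simp_all add: free_algebra_def)

lemma free_algebra_carrier:
  "f \<in> carrier (free_algebra X) \<longleftrightarrow>
     (\<forall>w \<in> Poly_Mapping.keys f. set (letters w) \<subseteq> X)"
  by (simp add: free_algebra_def)

lemma free_algebra_zero_closed: "0 \<in> carrier (free_algebra X)"
  by (simp add: free_algebra_carrier)

lemma free_algebra_one_closed: "1 \<in> carrier (free_algebra X)"
  by (auto simp: free_algebra_carrier in_keys_iff lookup_one when_def split: if_splits)

lemma free_algebra_add_closed:
  "f \<in> carrier (free_algebra X) \<Longrightarrow> g \<in> carrier (free_algebra X) \<Longrightarrow>
     f + g \<in> carrier (free_algebra X)"
  using keys_add[of f g] by (auto simp: free_algebra_carrier)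

lemma free_algebra_uminus_closed:
  "f \<in> carrier (free_algebra X) \<Longrightarrow> - f \<in> carrier (free_algebra X)"
  by (simp add: free_algebra_carrier)

lemma free_algebra_diff_closed:
  "f \<in> carrier (free_algebra X) \<Longrightarrow> g \<in> carrier (free_algebra X) \<Longrightarrow>
     f - g \<in> carrier (free_algebra X)"
  using keys_diff[of f g] by (auto simp: free_algebra_carrier)

lemma free_algebra_mult_closed:
  "f \<in> carrier (free_algebra X) \<Longrightarrow> g \<in> carrier (free_algebra X) \<Longrightarrow>
     f * g \<in> carrier (free_algebra X)"
  using keys_mult[of f g] by (fastforce simp: free_algebra_carrier)

lemma free_algebra_const_closed:
  "Poly_Mapping.single 0 c \<in> carrier (free_algebra X)"
  by (auto simp: free_algebra_carrier in_keys_iff lookup_single when_def split: if_splits)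

lemma free_algebra_gen_closed:
  "x \<in> X \<Longrightarrow> free_gen x \<in> carrier (free_algebra X)"
  by (auto simp: free_algebra_carrier free_gen_def in_keys_iff lookup_single when_def
      split: if_splits)

lemmas free_algebra_closed =
  free_algebra_zero_closed free_algebra_one_closed free_algebra_add_closed
  free_algebra_uminus_closed free_algebra_diff_closed free_algebra_mult_closed
  free_algebra_const_closed free_algebra_gen_closed

lemma ring_free_algebra: "ring (free_algebra X :: ('k::field, 'x free_monoid \<Rightarrow>\<^sub>0 'k) module)"
proof (rule ringI)
  show "abelian_group (free_algebra X :: ('k, 'x free_monoid \<Rightarrow>\<^sub>0 'k) module)"
  proof (rule abelian_groupI)
    fix f :: "'x free_monoid \<Rightarrow>\<^sub>0 'k"
    assume "f \<in> carrier (free_algebra X)"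
    then show "\<exists>g\<in>carrier (free_algebra X). g \<oplus>\<^bsub>free_algebra X\<^esub> f = \<zero>\<^bsub>free_algebra X\<^esub>"
      by (intro bexI[of _ "- f"]) (simp_all add: free_algebra_simps free_algebra_closed)
  qed (simp_all add: free_algebra_simps free_algebra_closed algebra_simps)
  show "Group.monoid (free_algebra X :: ('k, 'x free_monoid \<Rightarrow>\<^sub>0 'k) module)"
    by (rule monoidI) (simp_all add: free_algebra_simps free_algebra_closed algebra_simps)
qed (simp_all add: free_algebra_simps algebra_simps)

lemma dd_relations_closed:
  "dd_relations q n \<subseteq> carrier (free_algebra (dd_index n))"
  unfolding dd_relations_def Let_def
  by (auto intro!: free_algebra_closed simp del: mem_Sigma_iff atLeastAtMost_iff)

lemma ideal_dd_ideal:
  "ideal (dd_ideal (q :: 'k::field) n) (free_algebra (dd_index n) :: ('k, _) module)"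
  unfolding dd_ideal_def
  by (rule ring.genideal_ideal[OF ring_free_algebra dd_relations_closed])

lemma quotient_algebra_simps:
  "carrier (quotient_algebra A I) = carrier (A Quot I)"
  "mult (quotient_algebra A I) = mult (A Quot I)"
  "one (quotient_algebra A I) = one (A Quot I)"
  "zero (quotient_algebra A I) = zero (A Quot I)"
  "add (quotient_algebra A I) = add (A Quot I)"
  "smult (quotient_algebra A I) c C = (\<Union>f\<in>C. I +>\<^bsub>A\<^esub> (c \<odot>\<^bsub>A\<^esub> f))"
  by (simp_all add: quotient_algebra_def ring.defs module.defs)

lemma smult_coset:
  fixes X :: "'x set" and c :: "'k::field"
  assumes I: "ideal I (free_algebra X :: ('k, _) module)"
    and f: "f \<in> carrier (free_algebra X :: ('k, _) module)"
  shows "c \<odot>\<^bsub>quotient_algebra (free_algebra X) I\<^esub> (I +>\<^bsub>free_algebra X :: ('k, _) module\<^esub> f)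
           = I +>\<^bsub>free_algebra X :: ('k, _) module\<^esub> (Poly_Mapping.single 0 c * f)"
proof -
  let ?F = "free_algebra X :: ('k, _) module"
  interpret ideal I ?F by (rule I)
  have "I +>\<^bsub>?F\<^esub> (Poly_Mapping.single 0 c * g) = I +>\<^bsub>?F\<^esub> (Poly_Mapping.single 0 c * f)"
    if "g \<in> I +>\<^bsub>?F\<^esub> f" for g
  proof -
    from that obtain h where h: "h \<in> I" "g = h + f"
      by (auto simp: a_r_coset_def' free_algebra_simps)
    have "Poly_Mapping.single 0 c * h \<in> I"
      using I_l_closed[OF h(1) free_algebra_const_closed] by (simp add: free_algebra_simps)
    then have "Poly_Mapping.single 0 c * g \<in> I +>\<^bsub>?F\<^esub> (Poly_Mapping.single 0 c * f)"
      by (auto simp: a_r_coset_def' free_algebra_simps h(2) distrib_left)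
    then show ?thesis
      by (rule a_repr_independence'[OF _ free_algebra_mult_closed[OF free_algebra_const_closed f],
            symmetric])
  qed
  moreover have "f \<in> I +>\<^bsub>?F\<^esub> f"
    using a_rcos_self[OF f] by simp
  ultimately have "(\<Union>g\<in>I +>\<^bsub>?F\<^esub> f. I +>\<^bsub>?F\<^esub> (Poly_Mapping.single 0 c * g))
      = I +>\<^bsub>?F\<^esub> (Poly_Mapping.single 0 c * f)"
    by blast
  then show ?thesis
    by (simp only: quotient_algebra_simps free_algebra_simps)
qed

lemma vectorspace_quotient_algebra:
  fixes X :: "'x set"
  assumes I: "ideal I (free_algebra X :: ('k::field, _) module)"
  shows "vectorspace (class_ring :: 'k ring) (quotient_algebra (free_algebra X) I)"
proof -
  let ?F = "free_algebra X :: ('k, _) module" and ?Q = "quotient_algebra (free_algebra X :: ('k, _) module) I"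
  interpret ideal I ?F by (rule I)
  interpret Q: ring "?F Quot I" by (rule quotient_is_ring)
  have coset: "\<exists>f\<in>carrier ?F. C = I +>\<^bsub>?F\<^esub> f" if "C \<in> carrier ?Q" for C
    using that by (auto simp: quotient_algebra_simps FactRing_simps)
  have cosetI: "I +>\<^bsub>?F\<^esub> f \<in> carrier ?Q" if "f \<in> carrier ?F" for f
    using that by (auto simp: quotient_algebra_simps FactRing_simps)
  have add: "(I +>\<^bsub>?F\<^esub> f) \<oplus>\<^bsub>?Q\<^esub> (I +>\<^bsub>?F\<^esub> g) = I +>\<^bsub>?F\<^esub> (f + g)"
    if "f \<in> carrier ?F" "g \<in> carrier ?F" for f g
    using a_rcos_sum[OF that]
    by (simp add: quotient_algebra_simps FactRing_def free_algebra_simps)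
  note smult = smult_coset[OF I]
  have "abelian_group ?Q"
  proof (rule abelian_groupI)
    fix C assume "C \<in> carrier ?Q"
    then show "\<exists>D\<in>carrier ?Q. D \<oplus>\<^bsub>?Q\<^esub> C = \<zero>\<^bsub>?Q\<^esub>"
      using Q.l_neg[of C] Q.a_inv_closed[of C] by (auto simp: quotient_algebra_simps)
  next
    fix C D E assume "C \<in> carrier ?Q" "D \<in> carrier ?Q" "E \<in> carrier ?Q"
    then show "C \<oplus>\<^bsub>?Q\<^esub> D \<oplus>\<^bsub>?Q\<^esub> E = C \<oplus>\<^bsub>?Q\<^esub> (D \<oplus>\<^bsub>?Q\<^esub> E)"
      by (simp add: quotient_algebra_simps Q.a_assoc)
  next
    fix C D assume "C \<in> carrier ?Q" "D \<in> carrier ?Q"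
    then show "C \<oplus>\<^bsub>?Q\<^esub> D = D \<oplus>\<^bsub>?Q\<^esub> C"
      by (simp add: quotient_algebra_simps Q.a_comm)
  qed (simp_all add: quotient_algebra_simps)
  then have "module (class_ring :: 'k ring) ?Q"
  proof (intro moduleI)
    show "cring (class_ring :: 'k ring)"
      by (rule class_cring.is_cring)
  next
    fix a :: 'k and C assume "C \<in> carrier ?Q"
    then obtain f where "f \<in> carrier ?F" "C = I +>\<^bsub>?F\<^esub> f" using coset by blast
    then show "a \<odot>\<^bsub>?Q\<^esub> C \<in> carrier ?Q"
      by (simp add: smult cosetI free_algebra_closed)
  next
    fix a b :: 'k and C assume "C \<in> carrier ?Q"
    then obtain f where "f \<in> carrier ?F" "C = I +>\<^bsub>?F\<^esub> f" using coset by blast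
    then show "(a \<oplus>\<^bsub>class_ring\<^esub> b) \<odot>\<^bsub>?Q\<^esub> C = a \<odot>\<^bsub>?Q\<^esub> C \<oplus>\<^bsub>?Q\<^esub> b \<odot>\<^bsub>?Q\<^esub> C"
      by (simp add: smult add free_algebra_closed single_add distrib_right)
  next
    fix a :: 'k and C D assume "C \<in> carrier ?Q" "D \<in> carrier ?Q"
    then obtain f g where "f \<in> carrier ?F" "C = I +>\<^bsub>?F\<^esub> f" "g \<in> carrier ?F" "D = I +>\<^bsub>?F\<^esub> g"
      using coset by metis
    then show "a \<odot>\<^bsub>?Q\<^esub> (C \<oplus>\<^bsub>?Q\<^esub> D) = a \<odot>\<^bsub>?Q\<^esub> C \<oplus>\<^bsub>?Q\<^esub> a \<odot>\<^bsub>?Q\<^esub> D"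
      by (simp add: smult add free_algebra_closed distrib_left)
  next
    fix a b :: 'k and C assume "C \<in> carrier ?Q"
    then obtain f where "f \<in> carrier ?F" "C = I +>\<^bsub>?F\<^esub> f" using coset by blast
    then show "(a \<otimes>\<^bsub>class_ring\<^esub> b) \<odot>\<^bsub>?Q\<^esub> C = a \<odot>\<^bsub>?Q\<^esub> (b \<odot>\<^bsub>?Q\<^esub> C)"
      by (simp add: smult free_algebra_closed mult_single mult.assoc[symmetric])
  next
    fix C assume "C \<in> carrier ?Q"
    then obtain f where "f \<in> carrier ?F" "C = I +>\<^bsub>?F\<^esub> f" using coset by blast
    then show "\<one>\<^bsub>class_ring :: 'k ring\<^esub> \<odot>\<^bsub>?Q\<^esub> C = C"
      by (simp add: smult)
  qed
  then show ?thesis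
    by (simp add: vectorspace_def class_field)
qed

lemma vectorspace_dd_algebra:
  "vectorspace (class_ring :: 'k::field ring) (dd_algebra (q :: 'k) n)"
  unfolding dd_algebra_def by (rule vectorspace_quotient_algebra[OF ideal_dd_ideal])

end

theory Submission
  imports Defs
begin

text \<open>
  The relations rewrite every word into a combination of lexicographically smaller words of the same
  length until its letters are in the prescribed order, so the ordered monomials span.

  For independence, \<open>D\<^sub>q(n)\<close> is made to act on the span of the ordered monomials. Moving a generator
  past the monomials of the first row yields operators in a quantum torus, which again satisfy the
  Dipper--Donkin relations; by the comultiplication, combining them with an action on the remaining
  rows gives an action on all rows. An ordered monomial applied to \<open>1\<close> returns itself, so the
  coefficients of a linear combination of ordered monomials can be read off.
\<close>

section \<open>Dipper-Donkin relations and products of matrices\<close>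

text \<open>Rows and columns have separate index sets because rectangular matrices occur:
  \<open>row_matrix\<close> is used with rows \<open>0..n\<close> and columns
  \<open>1..n\<close>.\<close>

definition dd_rels :: "'a::ring_1 \<Rightarrow> nat set \<Rightarrow> nat set \<Rightarrow> (nat \<Rightarrow> nat \<Rightarrow> 'a) \<Rightarrow> bool" where
  "dd_rels q I J d \<longleftrightarrow>
     (\<forall>i\<in>I. \<forall>s\<in>I. \<forall>j\<in>J. \<forall>t\<in>J.
        (i > s \<and> j \<le> t \<longrightarrow> d i j * d s t = q * (d s t * d i j)) \<and>
        (i > s \<and> j > t \<longrightarrow> d i j * d s t = d s t * d i j + (q - 1) * (d s j * d i t)) \<and>
        d i j * d i t = d i t * d i j)"

lemma dd_relsD:
  assumes "dd_rels q I J d"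
  shows "i \<in> I \<Longrightarrow> s \<in> I \<Longrightarrow> j \<in> J \<Longrightarrow> t \<in> J \<Longrightarrow> i > s \<Longrightarrow> j \<le> t \<Longrightarrow> d i j * d s t = q * (d s t * d i j)"
    and "i \<in> I \<Longrightarrow> s \<in> I \<Longrightarrow> j \<in> J \<Longrightarrow> t \<in> J \<Longrightarrow> i > s \<Longrightarrow> j > t \<Longrightarrow>
      d i j * d s t = d s t * d i j + (q - 1) * (d s j * d i t)"
    and "i \<in> I \<Longrightarrow> j \<in> J \<Longrightarrow> t \<in> J \<Longrightarrow> d i j * d i t = d i t * d i j"
  using assms unfolding dd_rels_def by blast+

text \<open>The terms at \<open>(u, v)\<close> and \<open>(v, u)\<close> cancel. The diagonal is a
  separate hypothesis because \<open>c u u = - c u u\<close> does not force \<open>c u u = 0\<close>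
  in the presence of 2-torsion.\<close>

lemma sum_antisymmetric_eq_0:
  fixes c :: "'b \<Rightarrow> 'b \<Rightarrow> 'a::ab_group_add"
  assumes "finite U" "\<And>u v. u \<in> U \<Longrightarrow> v \<in> U \<Longrightarrow> c u v = - c v u" "\<And>u. u \<in> U \<Longrightarrow> c u u = 0"
  shows "(\<Sum>u\<in>U. \<Sum>v\<in>U. c u v) = 0"
  using assms
proof (induction U rule: finite_induct)
  case (insert x U)
  have "(\<Sum>v\<in>U. c x v) = - (\<Sum>u\<in>U. c u x)"
    unfolding sum_negf[symmetric] by (rule sum.cong) (use insert.prems(1) in blast)+
  moreover have "(\<Sum>u\<in>U. \<Sum>v\<in>U. c u v) = 0" "c x x = 0"
    by (rule insert.IH) (use insert.prems in blast)+
  ultimately show ?case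
    using insert.hyps by (simp add: sum.distrib)
qed simp

context
  fixes q :: "'a::ring_1" and I U J :: "nat set" and a d :: "nat \<Rightarrow> nat \<Rightarrow> 'a"
  assumes q: "\<And>x. q * x = x * q"
    and U: "finite U"
    and d: "dd_rels q I U d" and a: "dd_rels q U J a"
    and comm: "\<And>i u v j. i \<in> I \<Longrightarrow> u \<in> U \<Longrightarrow> v \<in> U \<Longrightarrow> j \<in> J \<Longrightarrow> a v j * d i u = d i u * a v j"
begin

text \<open>Moving \<open>d i u\<close> past \<open>a v t\<close> by \<open>comm\<close> separates
  the entries of the two matrices.\<close>

lemma matrix_product_entries:
  assumes "i \<in> I" "s \<in> I" "j \<in> J" "t \<in> J"
  shows "(\<Sum>u\<in>U. a u j * d i u) * (\<Sum>v\<in>U. a v t * d s v)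
      = (\<Sum>u\<in>U. \<Sum>v\<in>U. a u j * a v t * (d i u * d s v))"
proof -
  have "a u j * d i u * (a v t * d s v) = a u j * a v t * (d i u * d s v)"
    if "u \<in> U" "v \<in> U" for u v
    using comm[of i u v t] that assms by (metis mult.assoc)
  then show ?thesis
    by (simp add: sum_product)
qed

text \<open>Brings all terms to the form \<open>d s v * d i u\<close>. A relation for the product
  matrix then follows by comparing coefficients, which involve only the entries of
  \<open>a\<close>.\<close>

lemma matrix_product_straighten:
  assumes "i \<in> I" "s \<in> I" "i > s"
  shows "(\<Sum>u\<in>U. \<Sum>v\<in>U. c u v * (d i u * d s v))
      = (\<Sum>u\<in>U. \<Sum>v\<in>U. (if u < v then q * c u v + (q - 1) * c v u
           else if u = v then q * c u v else c u v) * (d s v * d i u))"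
proof -
  have q1: "(q - 1) * x = x * (q - 1)" for x
    by (simp add: algebra_simps q)
  have "(\<Sum>u\<in>U. \<Sum>v\<in>U. c u v * (d i u * d s v))
      = (\<Sum>u\<in>U. \<Sum>v\<in>U. (if u \<le> v then q * c u v else c u v) * (d s v * d i u)
          + (if v < u then (q - 1) * c u v * (d s u * d i v) else 0))"
  proof (intro sum.cong refl)
    fix u v assume uv: "u \<in> U" "v \<in> U"
    show "c u v * (d i u * d s v) = (if u \<le> v then q * c u v else c u v) * (d s v * d i u)
          + (if v < u then (q - 1) * c u v * (d s u * d i v) else 0)"
    proof (cases "u \<le> v")
      case True
      then have *: "d i u * d s v = q * (d s v * d i u)"
        using dd_relsD(1)[OF d] assms uv by auto
      have "c u v * (q * (d s v * d i u)) = q * c u v * (d s v * d i u)"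
        by (metis q mult.assoc)
      with * True show ?thesis by simp
    next
      case False
      then have *: "d i u * d s v = d s v * d i u + (q - 1) * (d s u * d i v)"
        using dd_relsD(2)[OF d] assms uv by auto
      have "c u v * ((q - 1) * (d s u * d i v)) = (q - 1) * c u v * (d s u * d i v)"
        by (metis q1 mult.assoc)
      with * False show ?thesis by (simp add: distrib_left)
    qed
  qed
  also have "\<dots> = (\<Sum>u\<in>U. \<Sum>v\<in>U. (if u \<le> v then q * c u v else c u v) * (d s v * d i u))
      + (\<Sum>u\<in>U. \<Sum>v\<in>U. if v < u then (q - 1) * c u v * (d s u * d i v) else 0)"
    by (simp add: sum.distrib)
  \<comment> \<open>Exchanging the summation indices turns the correction terms
    \<open>d s u * d i v\<close> into \<open>d s v * d i u\<close>, so they join the coefficients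
    with \<open>u < v\<close>.\<close>
  also have "(\<Sum>u\<in>U. \<Sum>v\<in>U. if v < u then (q - 1) * c u v * (d s u * d i v) else 0)
      = (\<Sum>u\<in>U. \<Sum>v\<in>U. if u < v then (q - 1) * c v u * (d s v * d i u) else 0)"
    by (rule sum.swap)
  also have "(\<Sum>u\<in>U. \<Sum>v\<in>U. (if u \<le> v then q * c u v else c u v) * (d s v * d i u)) + \<dots>
     = (\<Sum>u\<in>U. \<Sum>v\<in>U. (if u < v then q * c u v + (q - 1) * c v u
           else if u = v then q * c u v else c u v) * (d s v * d i u))"
    unfolding sum.distrib[symmetric] by (intro sum.cong refl) (auto simp: distrib_right)
  finally show ?thesis .
qed

text \<open>
  The comultiplication \<open>d i j \<mapsto> (\<Sum>u. d u j \<otimes> d i u)\<close> of the Dipper--Donkin bialgebra, evaluated in two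
  commuting representations.
\<close>

lemma dd_rels_matrix_product: "dd_rels q I J (\<lambda>i j. \<Sum>u\<in>U. a u j * d i u)"
  unfolding dd_rels_def
proof (intro ballI conjI impI)
  note rel = dd_relsD[OF a]
  fix i s j t
  assume ind: "i \<in> I" "s \<in> I" "j \<in> J" "t \<in> J"
  let ?d = "\<lambda>i j. \<Sum>u\<in>U. a u j * d i u"
  have lin: "q * (\<Sum>u\<in>U. \<Sum>v\<in>U. c u v * (e u v)) = (\<Sum>u\<in>U. \<Sum>v\<in>U. (q * c u v) * e u v)"
     "(q - 1) * (\<Sum>u\<in>U. \<Sum>v\<in>U. c u v * (e u v)) = (\<Sum>u\<in>U. \<Sum>v\<in>U. ((q - 1) * c u v) * e u v)" for c e
    by (simp_all add: sum_distrib_left mult.assoc)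
  have swapped: "?d s t' * ?d i j' = (\<Sum>u\<in>U. \<Sum>v\<in>U. a v t' * a u j' * (d s v * d i u))"
    if "t' \<in> J" "j' \<in> J" for t' j'
    unfolding matrix_product_entries[OF ind(2,1) that] by (rule sum.swap)
  {
    assume gt: "i > s \<and> j \<le> t"
    \<comment> \<open>The coefficients of \<open>d s v * d i u\<close> on the two sides agree by the
      relations for \<open>a\<close>; the order of \<open>u\<close> and \<open>v\<close> decides
      which relation applies.\<close>
    have coeff: "(if u < v then q * (a u j * a v t) + (q - 1) * (a v j * a u t)
           else if u = v then q * (a u j * a v t) else a u j * a v t) = q * (a v t * a u j)"
      if uv: "u \<in> U" "v \<in> U" for u v
    proof (cases rule: linorder_cases[of u v])
      case less
      have 1: "a v j * a u t = q * (a u t * a v j)"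
        using rel(1)[of v u j t] uv ind gt less by auto
      show ?thesis
      proof (cases "j = t")
        case True
        then show ?thesis using 1 less by (simp add: algebra_simps)
      next
        case False
        then have "a v t * a u j = a u j * a v t + (q - 1) * (a u t * a v j)"
          using rel(2)[of v u t j] uv ind gt less by auto
        moreover have "(q - 1) * (q * x) = q * ((q - 1) * x)" for x
          by (simp add: algebra_simps)
        ultimately show ?thesis using 1 less by (simp add: distrib_left)
      qed
    next
      case equal
      then show ?thesis using rel(3)[of u j t] uv ind by auto
    next
      case greater
      then show ?thesis using rel(1)[of u v j t] uv ind gt by auto
    qed
    then show "?d i j * ?d s t = q * (?d s t * ?d i j)"
      unfolding swapped[OF ind(4,3)] matrix_product_entries[OF ind] lin
        matrix_product_straighten[OF ind(1,2) conjunct1[OF gt]]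
      by (intro sum.cong refl) (simp add: coeff)
  }
  {
    assume gt: "i > s \<and> j > t"
    have coeff: "(if u < v then q * (a u j * a v t) + (q - 1) * (a v j * a u t)
           else if u = v then q * (a u j * a v t) else a u j * a v t)
        = a v t * a u j + (q - 1) * (a v j * a u t)"
      if uv: "u \<in> U" "v \<in> U" for u v
    proof (cases rule: linorder_cases[of u v])
      case less
      then show ?thesis using rel(1)[of v u t j] uv ind gt by auto
    next
      case equal
      then show ?thesis using rel(3)[of u j t] uv ind by (simp add: algebra_simps)
    next
      case greater
      then show ?thesis using rel(2)[of u v j t] uv ind gt by auto
    qed
    then show "?d i j * ?d s t = ?d s t * ?d i j + (q - 1) * (?d s j * ?d i t)"
      unfolding swapped[OF ind(4,3)] swapped[OF ind(3,4)] matrix_product_entries[OF ind] lin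
        matrix_product_straighten[OF ind(1,2) conjunct1[OF gt]] sum.distrib[symmetric]
      by (intro sum.cong refl) (simp add: coeff distrib_right)
  }
  \<comment> \<open>\<open>c u v\<close> is the coefficient of \<open>d i u * d i v\<close> in the
    commutator. It is antisymmetric in \<open>u\<close> and \<open>v\<close>, while
    \<open>d i u * d i v\<close> is symmetric, so the double sum vanishes.\<close>
  define c where "c u v = a u j * a v t - a u t * a v j" for u v
  have comm_i: "d i u * d i v = d i v * d i u" if "u \<in> U" "v \<in> U" for u v
    using dd_relsD(3)[OF d] ind that by blast
  have anti: "c u v = - c v u" if uv: "u \<in> U" "v \<in> U" for u v
  proof -
    \<comment> \<open>The terms with factor \<open>q\<close> cancel between the two relations. The
      other orders of the indices follow by exchanging \<open>u\<close> with \<open>v\<close> or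
      \<open>j\<close> with \<open>t\<close>.\<close>
    have *: "a u j * a v t - a u t * a v j = - (a v j * a u t - a v t * a u j)"
      if "u < v" "u \<in> U" "v \<in> U" "t \<in> J" "j \<in> J" "j < t" for u v j t
      using rel(2)[of v u t j] rel(1)[of v u j t] that by (simp add: algebra_simps)
    consider "j = t" | "u = v" | "u < v" "j < t" | "v < u" "t < j" | "u < v" "t < j" | "v < u" "j < t"
      by linarith
    then show ?thesis
    proof cases
      case 1 then show ?thesis by (simp add: c_def)
    next
      case 2 then show ?thesis using rel(3)[OF uv(1) ind(3,4)] by (simp add: c_def)
    next
      case 3 then show ?thesis unfolding c_def using * uv ind by blast
    next
      case 4 then show ?thesis unfolding c_def using *[of v u j t] *[of v u t j] uv ind
        by (simp add: algebra_simps)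
    next
      case 5 then show ?thesis unfolding c_def using *[of u v j t] uv ind
        by (metis minus_diff_eq)
    next
      case 6 then show ?thesis unfolding c_def using *[of v u t j] uv ind
        by (metis minus_minus)
    qed
  qed
  have "?d i j * ?d i t - ?d i t * ?d i j = (\<Sum>u\<in>U. \<Sum>v\<in>U. c u v * (d i u * d i v))"
    using ind by (simp add: matrix_product_entries c_def sum_subtractf left_diff_distrib)
  also have "\<dots> = 0"
  proof (rule sum_antisymmetric_eq_0[OF U])
    fix u v assume uv: "u \<in> U" "v \<in> U"
    show "c u v * (d i u * d i v) = - (c v u * (d i v * d i u))"
      using anti[OF uv] comm_i[OF uv] by simp
    show "c u u * (d i u * d i u) = 0"
      using rel(3)[OF uv(1) ind(3,4)] by (simp add: c_def)
  qed
  finally show "?d i j * ?d i t = ?d i t * ?d i j"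
    by simp
qed

end

section \<open>Operators on functions of monomials\<close>

typedef (overloaded) ('s, 'k::field) lin_op =
  "{T :: ('s \<Rightarrow> 'k) \<Rightarrow> ('s \<Rightarrow> 'k).
      (\<forall>F G. T (\<lambda>s. F s + G s) = (\<lambda>s. T F s + T G s)) \<and>
      (\<forall>c F. T (\<lambda>s. c * F s) = (\<lambda>s. c * T F s))}"
  morphisms act Lin_op
  by (rule exI[of _ id]) auto

setup_lifting type_definition_lin_op

text \<open>
  Functions on monomials are dual to the algebra spanned by the monomials, so operators on them
  compose in reverse order.
\<close>

instantiation lin_op :: (type, field) ring_1
begin

lift_definition zero_lin_op :: "('a, 'b) lin_op" is "\<lambda>F s. 0" by simp
lift_definition one_lin_op :: "('a, 'b) lin_op" is "\<lambda>F. F" by simp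
lift_definition plus_lin_op :: "('a, 'b) lin_op \<Rightarrow> ('a, 'b) lin_op \<Rightarrow> ('a, 'b) lin_op"
  is "\<lambda>S T F s. S F s + T F s" by (simp add: algebra_simps)
lift_definition uminus_lin_op :: "('a, 'b) lin_op \<Rightarrow> ('a, 'b) lin_op"
  is "\<lambda>S F s. - S F s" by simp
lift_definition minus_lin_op :: "('a, 'b) lin_op \<Rightarrow> ('a, 'b) lin_op \<Rightarrow> ('a, 'b) lin_op"
  is "\<lambda>S T F s. S F s - T F s" by (simp add: algebra_simps)
lift_definition times_lin_op :: "('a, 'b) lin_op \<Rightarrow> ('a, 'b) lin_op \<Rightarrow> ('a, 'b) lin_op"
  is "\<lambda>S T F. T (S F)" by simp

instance
proof
  show "(0 :: ('a, 'b) lin_op) \<noteq> 1"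
  proof transfer
    show "(\<lambda>F s. 0) \<noteq> (\<lambda>F :: 'a \<Rightarrow> 'b. F)"
      using fun_cong[of "\<lambda>F s. 0" "\<lambda>F :: 'a \<Rightarrow> 'b. F" "\<lambda>s. 1"] by (auto simp: fun_eq_iff)
  qed
qed (transfer; force simp: fun_eq_iff algebra_simps)+

end

lift_definition scalar_op :: "'k::field \<Rightarrow> ('s, 'k) lin_op" is "\<lambda>c F s. c * F s"
  by (simp add: algebra_simps)

text \<open>The transpose of the weighted shift that sends the monomial with exponents
  \<open>m\<close> to \<open>c m\<close> times the monomial with exponents
  \<open>m + v\<close>.\<close>

lift_definition shift_op :: "(('i \<Rightarrow> int) \<Rightarrow> 'k::field) \<Rightarrow> ('i \<Rightarrow> int) \<Rightarrow> ('i \<Rightarrow> int, 'k) lin_op"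
  is "\<lambda>c v F m. c m * F (\<lambda>p. m p + v p)"
  by (simp add: algebra_simps)

lemma act_sum: "act (sum T A) F s = (\<Sum>x\<in>A. act (T x) F s)"
  by (induction A rule: infinite_finite_induct) (simp_all add: zero_lin_op.rep_eq plus_lin_op.rep_eq)

lemma act_simps:
  "act 0 F s = 0" "act 1 F = F" "act (S + T) F s = act S F s + act T F s"
  "act (S * T) F = act T (act S F)" "act (scalar_op c) F s = c * F s"
  "act (shift_op b v) F m = b m * F (\<lambda>p. m p + v p)"
  by (transfer, simp)+

lemma scalar_op_simps:
  "scalar_op 0 = 0" "scalar_op 1 = 1" "scalar_op (a + b) = scalar_op a + scalar_op b"
  "scalar_op (a - b) = scalar_op a - scalar_op b"
  "scalar_op (a * b) = scalar_op a * scalar_op b"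
  by (transfer, simp add: fun_eq_iff algebra_simps)+

lemma scalar_op_commute: "scalar_op c * T = T * scalar_op c"
  by transfer simp

section \<open>The action of the generators, one row at a time\<close>

abbreviation unit_exp :: "'i \<Rightarrow> 'i \<Rightarrow> int" where
  "unit_exp x \<equiv> \<lambda>p. of_bool (p = x)"

text \<open>The scalar gained when a generator \<open>d i u\<close> of a later row passes the
  letters of row \<open>r\<close> in columns \<open>u, ..., n\<close>, with each of which it
  commutes up to a factor \<open>q\<close>.\<close>

definition tail_power :: "'k::field \<Rightarrow> nat \<Rightarrow> nat \<Rightarrow> nat \<Rightarrow> (nat \<times> nat \<Rightarrow> int) \<Rightarrow> 'k" where
  "tail_power q n r u m = q powi (\<Sum>s\<in>{u..n}. m (r, s))"

text \<open>
  The operators that arise when a generator of a later row is moved to the right past a monomial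
  \<open>m\<close> in the commuting variables \<open>x\<^sub>1, \<dots>, x\<^sub>n\<close> of row \<open>r\<close>:
  \<open>d i j * m = (\<Sum>u\<ge>1. row_matrix u j m * d i u)\<close>, while row \<open>0\<close> of the matrix holds the multiplications
  by \<open>x\<^sub>j\<close>. Exponents are integers so that no case distinction is needed where an exponent of \<open>x\<^sub>u\<close>
  is lowered: the coefficient vanishes whenever that exponent is \<open>0\<close>.
\<close>

definition row_matrix ::
    "'k::field \<Rightarrow> nat \<Rightarrow> nat \<Rightarrow> nat \<Rightarrow> nat \<Rightarrow> (nat \<times> nat \<Rightarrow> int, 'k) lin_op" where
  "row_matrix q n r u j =
     (if u = 0 then shift_op (\<lambda>m. 1) (unit_exp (r, j))
      else if u < j then
        shift_op (\<lambda>m. tail_power q n r u m - tail_power q n r (Suc u) m)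
          (\<lambda>p. unit_exp (r, j) p - unit_exp (r, u) p)
      else if u = j then shift_op (tail_power q n r u) (\<lambda>p. 0)
      else 0)"

text \<open>The commutation rules of the quantum torus: a tail starting at \<open>u\<close> sees a
  change of the exponent in column \<open>j\<close> exactly if \<open>u <= j\<close>.\<close>

lemma tail_power_shift:
  assumes "q \<noteq> 0" "j \<le> n"
  shows "tail_power q n r u (\<lambda>p. m p + unit_exp (r, j) p)
           = (if u \<le> j then q else 1) * tail_power q n r u m"
    and "u' \<le> n \<Longrightarrow> tail_power q n r u (\<lambda>p. m p + (unit_exp (r, j) p - unit_exp (r, u') p))
           = (if u \<le> j then q else 1) / (if u \<le> u' then q else 1) * tail_power q n r u m"
proof -
  have 1: "(\<Sum>s\<in>{u..n}. unit_exp (r, j) (r, s)) = of_bool (u \<le> j)" if "j \<le> n" for j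
  proof -
    have "(\<Sum>s\<in>{u..n}. unit_exp (r, j) (r, s)) = (\<Sum>s\<in>{u..n}. if s = j then 1 else 0)"
      by (rule sum.cong) auto
    then show ?thesis using that by (simp add: sum.delta)
  qed
  show "tail_power q n r u (\<lambda>p. m p + unit_exp (r, j) p)
           = (if u \<le> j then q else 1) * tail_power q n r u m"
    unfolding tail_power_def sum.distrib 1[OF assms(2)]
    using assms by (simp add: power_int_add)
  show "tail_power q n r u (\<lambda>p. m p + (unit_exp (r, j) p - unit_exp (r, u') p))
           = (if u \<le> j then q else 1) / (if u \<le> u' then q else 1) * tail_power q n r u m"
    if "u' \<le> n"
    unfolding tail_power_def sum.distrib sum_subtractf 1[OF assms(2)] 1[OF that]
    using assms by (simp add: power_int_add power_int_diff)
qed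

lemma lin_op_eqI: "(\<And>F m. act S F m = act T F m) \<Longrightarrow> S = T"
  by (metis act_inject ext)

lemma act_row_matrix:
  "act (row_matrix q n r u j) F m =
     (if u = 0 then F (\<lambda>p. m p + unit_exp (r, j) p)
      else if u < j then (tail_power q n r u m - tail_power q n r (Suc u) m) *
        F (\<lambda>p. m p + (unit_exp (r, j) p - unit_exp (r, u) p))
      else if u = j then tail_power q n r u m * F m
      else 0)"
  by (simp add: row_matrix_def act_simps)

text \<open>All nonzero products occurring in one relation shift the exponents by the same vector.
  Only their coefficients have to be compared, and \<open>tail_power_shift\<close> turns these into
  field identities.\<close>

lemma dd_rels_row_matrix:
  assumes q: "q \<noteq> 0"
  shows "dd_rels (scalar_op q) {0..n} {1..n} (row_matrix q n r)"
  unfolding dd_rels_def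
proof (intro ballI conjI impI)
  note defs = act_row_matrix act_simps(3,4,5) scalar_op_simps(2,4)[symmetric] tail_power_shift[OF q]
  fix i s j t assume *: "i \<in> {0..n}" "s \<in> {0..n}" "j \<in> {1..n}" "t \<in> {1..n}"
  let ?a = "row_matrix q n r"
  have one: "scalar_op q - 1 = scalar_op (q - 1)" by (simp add: scalar_op_simps)
  {
    assume lt: "s < i \<and> j \<le> t"
    then show "?a i j * ?a s t = scalar_op q * (?a s t * ?a i j)"
      using * q lt by (intro lin_op_eqI) (simp add: defs, simp_all add: field_simps)
  }
  {
    assume lt: "s < i \<and> t < j"
    then show "?a i j * ?a s t = ?a s t * ?a i j + (scalar_op q - 1) * (?a s j * ?a i t)"
      unfolding one
      using * q lt by (intro lin_op_eqI) (simp add: defs, simp_all add: field_simps)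
  }
  show "?a i j * ?a i t = ?a i t * ?a i j"
    using * q by (intro lin_op_eqI) (simp add: defs, simp_all add: field_simps)
qed

text \<open>Each operator reads and changes only the exponents of its own row.\<close>

lemma row_matrix_commute:
  assumes "r \<noteq> r'"
  shows "row_matrix q n r u j * row_matrix q n r' v t = row_matrix q n r' v t * row_matrix q n r u j"
proof -
  have inv: "tail_power q n r u (\<lambda>p. m p + w p) = tail_power q n r u m" if "\<And>s. w (r, s) = 0" for r u m w
    using that by (simp add: tail_power_def)
  show ?thesis
    using assms
    by (intro lin_op_eqI) (simp add: act_row_matrix act_simps inv, simp add: algebra_simps)
qed

text \<open>Only the last \<open>k\<close> of the \<open>n\<close> rows act nontrivially.\<close>

primrec row_action :: "'k::field \<Rightarrow> nat \<Rightarrow> nat \<Rightarrow> nat \<Rightarrow> nat \<Rightarrow> (nat \<times> nat \<Rightarrow> int, 'k) lin_op" where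
  "row_action q n 0 = (\<lambda>i j. 0)"
| "row_action q n (Suc k) = (\<lambda>i j. \<Sum>u\<in>{0..n}. row_matrix q n (n - k) u j *
     (if u = 0 then of_bool (i = n - k) else row_action q n k i u))"

lemma row_action_eq_0: "k \<le> n \<Longrightarrow> i \<le> n - k \<Longrightarrow> row_action q n k i j = 0"
  by (induction k arbitrary: j) auto

text \<open>\<open>row_action q n k\<close> is built from the matrices of the rows after
  \<open>n - k\<close> only, so \<open>row_matrix_commute\<close> applies to each of them.\<close>

lemma row_action_commute:
  assumes "r \<le> n - k" "k \<le> n"
  shows "row_matrix q n r u j * row_action q n k i v = row_action q n k i v * row_matrix q n r u j"
  using assms
proof (induction k arbitrary: v)
  case (Suc k)
  have comm_mult: "x * (a * e) = a * e * x" if "x * e = e * x" "x * a = a * x"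
    for x a e :: "(nat \<times> nat \<Rightarrow> int, 'a) lin_op"
    using that by (metis mult.assoc)
  show ?case
    unfolding row_action.simps sum_distrib_left sum_distrib_right
  proof (rule sum.cong)
    fix w
    let ?e = "if w = 0 then of_bool (i = n - k) else row_action q n k i w"
    have "row_matrix q n r u j * ?e = ?e * row_matrix q n r u j"
      using Suc.IH[of w] Suc.prems by auto
    moreover have "row_matrix q n r u j * row_matrix q n (n - k) w v
        = row_matrix q n (n - k) w v * row_matrix q n r u j"
      using Suc.prems by (intro row_matrix_commute) auto
    ultimately show "row_matrix q n r u j * (row_matrix q n (n - k) w v * ?e)
        = row_matrix q n (n - k) w v * ?e * row_matrix q n r u j"
      by (rule comm_mult)
  qed simp
qed simp

text \<open>Induction on the number of rows: the action of the later rows, bordered by a column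
  \<open>0\<close> for the new row, is multiplied by the matrix of that row, and
  \<open>dd_rels_matrix_product\<close> applies.\<close>

lemma dd_rels_row_action:
  assumes "q \<noteq> 0" "k \<le> n"
  shows "dd_rels (scalar_op q) UNIV {1..n} (row_action q n k)"
  using assms(2)
proof (induction k)
  case 0
  then show ?case by (simp add: dd_rels_def)
next
  case (Suc k)
  let ?e = "\<lambda>i u. if u = 0 then of_bool (i = n - k) else row_action q n k i u"
  show ?case
    unfolding row_action.simps
  proof (rule dd_rels_matrix_product)
    show "scalar_op q * x = x * scalar_op q" for x
      by (rule scalar_op_commute)
    show "dd_rels (scalar_op q) {0..n} {1..n} (row_matrix q n (n - k))"
      by (rule dd_rels_row_matrix[OF assms(1)])
    show "row_matrix q n (n - k) v j * ?e i u = ?e i u * row_matrix q n (n - k) v j"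
      for i u v j :: nat
      using row_action_commute[of "n - k" n k q v j i u] Suc.prems by auto
    have rel: "dd_rels (scalar_op q) UNIV {1..n} (row_action q n k)"
      using Suc by simp
    \<comment> \<open>Column \<open>0\<close> of \<open>?e\<close> is the unit vector of row
      \<open>n - k\<close>. For \<open>s < i\<close> at most one of \<open>?e i 0\<close> and
      \<open>?e s 0\<close> is nonzero, and \<open>?e s j\<close> with \<open>j > 0\<close> vanishes
      for \<open>s <= n - k\<close>; this settles the relations that involve the new column.\<close>
    show "dd_rels (scalar_op q) UNIV {0..n} ?e"
      unfolding dd_rels_def
    proof (intro ballI conjI impI)
      fix i s j t :: nat
      assume *: "j \<in> {0..n}" "t \<in> {0..n}"
      {
        assume lt: "s < i \<and> j \<le> t"
        show "?e i j * ?e s t = scalar_op q * (?e s t * ?e i j)"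
          using dd_relsD(1)[OF rel, of i s j t] lt * row_action_eq_0[of k n s q t] Suc.prems by auto
      }
      {
        assume lt: "s < i \<and> t < j"
        show "?e i j * ?e s t = ?e s t * ?e i j + (scalar_op q - 1) * (?e s j * ?e i t)"
          using dd_relsD(2)[OF rel, of i s j t] lt * row_action_eq_0[of k n s q j] Suc.prems by auto
      }
      show "?e i j * ?e i t = ?e i t * ?e i j"
        using dd_relsD(3)[OF rel, of i j t] * by auto
    qed
  qed simp
qed

text \<open>In front of a monomial without letters in earlier rows a generator needs no reordering.
  On an empty row all tails are \<open>1\<close>, so the rows \<open>u > 0\<close> of
  \<open>row_matrix\<close> act as an identity matrix; in row \<open>i\<close> itself only the
  multiplication \<open>u = 0\<close> remains.\<close>

lemma act_row_action:
  assumes "k \<le> n" "n - k < i" "i \<le> n" "j \<in> {1..n}" "\<And>r s. r < i \<Longrightarrow> m (r, s) = 0"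
  shows "act (row_action q n k i j) F m = F (\<lambda>p. m p + unit_exp (i, j) p)"
  using assms
proof (induction k arbitrary: F j)
  case (Suc k)
  show ?case
  proof (cases "i = n - k")
    case True
    have "(\<Sum>u\<in>{0..n}. row_matrix q n (n - k) u j * (if u = 0 then of_bool (i = n - k) else row_action q n k i u))
        = (\<Sum>u\<in>{0..n}. if u = 0 then row_matrix q n i 0 j else 0)"
      using True Suc.prems by (intro sum.cong) (auto simp: row_action_eq_0)
    then show ?thesis
      by (simp add: act_row_matrix)
  next
    case False
    have tail: "tail_power q n (n - k) u (\<lambda>p. m p + unit_exp (i, v) p) = 1" for u v
      using False Suc.prems by (simp add: tail_power_def)
    have "act (row_matrix q n (n - k) u j * (if u = 0 then of_bool (i = n - k) else row_action q n k i u)) F m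
        = (if u = j then F (\<lambda>p. m p + unit_exp (i, j) p) else 0)" if "u \<in> {0..n}" for u
    proof (cases "u = 0")
      case True
      then show ?thesis using False Suc.prems(4) by (simp add: act_simps)
    next
      case u: False
      let ?m = "\<lambda>p. m p + unit_exp (i, u) p"
      \<comment> \<open>Products act in reverse order, so the induction hypothesis is applied to the
        function \<open>act (row_matrix q n (n - k) u j) F\<close> in place of
        \<open>F\<close>.\<close>
      have "act (row_action q n k i u) (act (row_matrix q n (n - k) u j) F) m
          = act (row_matrix q n (n - k) u j) F ?m"
        by (rule Suc.IH) (use False Suc.prems that u in auto)
      also have "\<dots> = (if u = j then F ?m else 0)"
        unfolding act_row_matrix tail using u by simp
      finally show ?thesis
        using u by (simp add: act_simps)
    qed
    then show ?thesis
      using Suc.prems by (simp add: act_sum)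
  qed
qed simp

section \<open>Ordered words\<close>

definition le_lex :: "nat \<times> nat \<Rightarrow> nat \<times> nat \<Rightarrow> bool" where
  "le_lex a b \<longleftrightarrow> fst a < fst b \<or> fst a = fst b \<and> snd a \<le> snd b"

definition power_word :: "'a list \<Rightarrow> ('a \<Rightarrow> nat) \<Rightarrow> 'a list" where
  "power_word xs k = concat (map (\<lambda>x. replicate (k x) x) xs)"

lemma power_word_simps [simp]:
  "power_word [] k = []" "power_word (x # xs) k = replicate (k x) x @ power_word xs k"
  "power_word (xs @ ys) k = power_word xs k @ power_word ys k"
  by (simp_all add: power_word_def)

lemma power_word_cong: "(\<And>x. x \<in> set xs \<Longrightarrow> k x = l x) \<Longrightarrow> power_word xs k = power_word xs l"
  unfolding power_word_def by (intro arg_cong[where f = concat] map_cong) auto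

lemma set_power_word_subset: "set (power_word xs k) \<subseteq> set xs"
  by (auto simp: power_word_def)

lemma count_list_power_word:
  "distinct xs \<Longrightarrow> count_list (power_word xs k) y = (if y \<in> set xs then k y else 0)"
proof (induction xs)
  case (Cons x xs)
  have "count_list (replicate m x) y = (if x = y then m else 0)" for m
    by (induction m) auto
  with Cons show ?case by auto
qed simp

lemma sorted_wrt_power_word:
  assumes "sorted_wrt R xs" "\<And>x. R x x"
  shows "sorted_wrt R (power_word xs k)"
  using assms(1)
proof (induction xs)
  case (Cons x xs)
  have "sorted_wrt R (replicate m x)" for m
    by (induction m) (auto simp: assms(2))
  with Cons set_power_word_subset[of xs k] show ?case
    by (auto simp: sorted_wrt_append)
qed simp

text \<open>A sorted word is determined by its multiplicities; this identifies sorted words with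
  ordered monomials.\<close>

lemma power_word_count_list:
  assumes "sorted_wrt R w" "set w \<subseteq> set xs" "sorted_wrt R xs" "distinct xs" "antisymp R"
  shows "power_word xs (count_list w) = w"
  using assms(1,2)
proof (induction w)
  case Nil
  then show ?case by (induction xs) auto
next
  case (Cons y w)
  then obtain us vs where xs: "xs = us @ y # vs"
    by (meson list.set_intros(1) split_list subsetD)
  \<comment> \<open>A letter \<open>x\<close> listed before \<open>y\<close> cannot occur in
    \<open>w\<close>: otherwise \<open>R x y\<close> and \<open>R y x\<close> would force
    \<open>x = y\<close>.\<close>
  have "count_list (y # w) x = 0 \<and> count_list w x = 0" if "x \<in> set us" for x
  proof -
    have "R x y" "x \<noteq> y"
      using assms(3,4) that by (auto simp: xs sorted_wrt_append)
    moreover from this have "x \<notin> set w"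
      using Cons.prems(1) assms(5) by (auto dest: antisympD)
    ultimately show ?thesis by simp
  qed
  then have "power_word us (count_list (y # w)) = []" "power_word us (count_list w) = []"
    by (auto simp: power_word_def)
  moreover have "power_word vs (count_list (y # w)) = power_word vs (count_list w)"
    using assms(4) by (intro power_word_cong) (auto simp: xs)
  moreover have "power_word xs (count_list w) = w"
    using Cons by simp
  moreover have "count_list (y # w) y = Suc (count_list w y)"
    by simp
  ultimately show ?case
    by (simp add: xs del: count_list.simps)
qed

lemma sorted_wrt_product:
  assumes "sorted_wrt (<) xs" "sorted_wrt (<) ys"
  shows "sorted_wrt le_lex (List.product xs ys)"
  using assms(1)
proof (induction xs)
  case (Cons x xs)
  have "sorted_wrt le_lex (map (Pair x) ys)"
    unfolding sorted_wrt_map by (rule sorted_wrt_mono_rel[OF _ assms(2)]) (auto simp: le_lex_def)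
  with Cons show ?case
    by (auto simp: sorted_wrt_append) (auto simp: le_lex_def)
qed simp

abbreviation dd_letters :: "nat \<Rightarrow> (nat \<times> nat) list" where
  "dd_letters n \<equiv> List.product [1..<Suc n] [1..<Suc n]"

lemma set_dd_letters: "set (dd_letters n) = dd_index n"
  by auto

lemma sorted_dd_letters: "sorted_wrt le_lex (dd_letters n)"
  by (rule sorted_wrt_product) (simp_all del: upt_Suc)

lemma distinct_dd_letters: "distinct (dd_letters n)"
  by (simp add: distinct_product del: upt_Suc)

text \<open>Since \<open>le_lex\<close> is transitive, sortedness can be tested on adjacent letters,
  so an unsorted word contains a pair to which a relation applies.\<close>

lemma unsorted_adjacent:
  assumes "\<not> sorted_wrt le_lex w"
  obtains u a b v where "w = u @ [a, b] @ v" "\<not> le_lex a b"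
proof -
  have "transp le_lex"
    by (auto simp: transp_def le_lex_def)
  then obtain i where i: "Suc i < length w" "\<not> le_lex (w ! i) (w ! Suc i)"
    using assms by (auto simp: sorted_wrt_iff_nth_Suc_transp)
  have "w = take i w @ [w ! i, w ! Suc i] @ drop (Suc (Suc i)) w"
    using i(1) by (simp add: Cons_nth_drop_Suc)
  then show thesis using i(2) by (rule that)
qed

section \<open>Representations of the free algebra\<close>

text \<open>The case of a single term is restricted to the words of \<open>f\<close>, so that
  membership of \<open>f\<close> in the carrier of a free algebra can be used there.\<close>

lemma poly_mapping_add_induct:
  fixes f :: "'a \<Rightarrow>\<^sub>0 'b::comm_monoid_add"
  assumes single: "\<And>w c. w \<in> Poly_Mapping.keys f \<Longrightarrow> P (Poly_Mapping.single w c)" and "P 0"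
    and add: "\<And>f g. P f \<Longrightarrow> P g \<Longrightarrow> P (f + g)"
  shows "P f"
proof -
  have "f = (\<Sum>w\<in>Poly_Mapping.keys f. Poly_Mapping.single w (Poly_Mapping.lookup f w))"
    by (rule poly_mapping_eqI)
      (auto simp: lookup_sum lookup_single when_def in_keys_iff sum.delta)
  moreover have "P (\<Sum>w\<in>A. Poly_Mapping.single w (Poly_Mapping.lookup f w))"
    if "finite A" "A \<subseteq> Poly_Mapping.keys f" for A
    using that
  proof (induction A rule: finite_induct)
    case (insert w A)
    then show ?case using add[OF single] by simp
  qed (simp add: \<open>P 0\<close>)
  ultimately show ?thesis by (metis subset_refl finite_keys)
qed

text \<open>The algebra homomorphism given by the universal property of the free algebra.\<close>

definition free_lift ::
    "('x \<Rightarrow> ('s, 'k::field) lin_op) \<Rightarrow> ('x free_monoid \<Rightarrow>\<^sub>0 'k) \<Rightarrow> ('s, 'k) lin_op" where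
  "free_lift d f =
     (\<Sum>w\<in>Poly_Mapping.keys f. scalar_op (Poly_Mapping.lookup f w) * prod_list (map d (letters w)))"

text \<open>Extra words contribute \<open>0\<close>. Over a common index set, additivity becomes a
  termwise identity.\<close>

lemma free_lift_superset:
  assumes "finite A" "Poly_Mapping.keys f \<subseteq> A"
  shows "free_lift d f = (\<Sum>w\<in>A. scalar_op (Poly_Mapping.lookup f w) * prod_list (map d (letters w)))"
  unfolding free_lift_def using assms
  by (intro sum.mono_neutral_left) (auto simp: in_keys_iff scalar_op_simps)

lemma free_lift_add: "free_lift d (f + g) = free_lift d f + free_lift d g"
  using keys_add[of f g]
  by (simp add: free_lift_superset[of "Poly_Mapping.keys f \<union> Poly_Mapping.keys g"] lookup_add scalar_op_simps
      distrib_right sum.distrib)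

lemma free_lift_0: "free_lift d 0 = 0"
  by (simp add: free_lift_def)

lemma free_lift_uminus: "free_lift d (- f) = - free_lift d f"
  by (metis add.right_inverse free_lift_0 free_lift_add minus_unique)

lemma free_lift_diff: "free_lift d (f - g) = free_lift d f - free_lift d g"
  by (metis free_lift_add free_lift_uminus diff_conv_add_uminus)

lemma free_lift_single:
  "free_lift d (Poly_Mapping.single w c) = scalar_op c * prod_list (map d (letters w))"
  by (simp add: free_lift_superset[of "{w}"])

lemma free_lift_gen: "free_lift d (free_gen x) = d x"
  by (simp add: free_gen_def free_lift_single scalar_op_simps)

lemma free_lift_scalar: "free_lift d (Poly_Mapping.single 0 c) = scalar_op c"
  by (simp add: free_lift_single)

lemma free_lift_mult:
  fixes d :: "'x \<Rightarrow> ('s, 'k::field) lin_op"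
  shows "free_lift d (f * g) = free_lift d f * free_lift d g"
proof (induction f rule: poly_mapping_add_induct)
  case (1 v b)
  show ?case
  proof (induction g rule: poly_mapping_add_induct)
    case (1 w c)
    have "scalar_op b * scalar_op c * (P * Q) = scalar_op b * P * (scalar_op c * Q)"
      for P Q :: "('s, 'k) lin_op"
      by (metis mult.assoc scalar_op_commute)
    then show ?case
      by (simp add: mult_single free_lift_single scalar_op_simps)
  qed (simp_all add: free_lift_0 free_lift_add distrib_left)
qed (simp_all add: free_lift_0 free_lift_add distrib_right)

lemma ideal_free_lift_kernel:
  fixes d :: "'x \<Rightarrow> ('s, 'k::field) lin_op" and X
  shows "ideal {f \<in> carrier (free_algebra X). free_lift d f = 0} (free_algebra X :: ('k, _) module)"
    (is "ideal ?K ?F")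
proof (rule idealI)
  show "ring ?F" by (rule ring_free_algebra)
  interpret ring ?F by (rule ring_free_algebra)
  have inv: "\<ominus>\<^bsub>?F\<^esub> f = - f" if "f \<in> carrier ?F" for f
    using that by (intro minus_equality) (simp_all add: free_algebra_simps free_algebra_closed)
  show "subgroup ?K (add_monoid ?F)"
    by (rule add.subgroupI)
      (auto simp: free_lift_0 free_lift_add free_lift_uminus free_algebra_simps free_algebra_closed
        inv simp flip: a_inv_def intro!: exI[of _ 0])
qed (simp_all add: free_lift_mult free_algebra_simps free_algebra_closed)

text \<open>The kernel of \<open>free_lift d\<close> is an ideal containing the defining relations,
  hence contains the ideal generated by them: \<open>d\<close> induces a representation of the
  quotient.\<close>

lemma dd_ideal_free_lift:
  fixes q :: "'k::field"
  assumes "dd_rels (scalar_op q) {1..n} {1..n} (\<lambda>i j. d (i, j))" "f \<in> dd_ideal q n"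
  shows "free_lift d f = (0 :: ('s, 'k) lin_op)"
proof -
  let ?F = "free_algebra (dd_index n) :: ('k, _) module"
  note rel = dd_relsD[OF assms(1)]
  note lift = free_lift_add free_lift_diff free_lift_mult free_lift_gen free_lift_scalar
  have "free_lift d r = 0" if r: "r \<in> dd_relations q n" for r
  proof -
    consider i j s t where
        "r = free_gen (i, j) * free_gen (s, t)
           - Poly_Mapping.single 0 q * (free_gen (s, t) * free_gen (i, j))"
        "(i, j) \<in> dd_index n" "(s, t) \<in> dd_index n" "i > s" "j \<le> t"
    | i j s t where
        "r = free_gen (i, j) * free_gen (s, t) - (free_gen (s, t) * free_gen (i, j)
           + Poly_Mapping.single 0 (q - 1) * (free_gen (s, j) * free_gen (i, t)))"
        "(i, j) \<in> dd_index n" "(s, t) \<in> dd_index n" "i > s" "j > t"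
    | i j k where "r = free_gen (i, j) * free_gen (i, k) - free_gen (i, k) * free_gen (i, j)"
        "(i, j) \<in> dd_index n" "(i, k) \<in> dd_index n"
      using r unfolding dd_relations_def Let_def by blast
    then show ?thesis
    proof cases
      case (1 i j s t)
      then show ?thesis using rel(1)[of i s j t] by (simp add: lift)
    next
      case (2 i j s t)
      then show ?thesis using rel(2)[of i s j t] by (simp add: lift scalar_op_simps)
    next
      case (3 i j k)
      then show ?thesis using rel(3)[of i j k] by (simp add: lift)
    qed
  qed
  then have "dd_relations q n \<subseteq> {f \<in> carrier ?F. free_lift d f = 0}"
    using dd_relations_closed[of q n] by blast
  then have "dd_ideal q n \<subseteq> {f \<in> carrier ?F. free_lift d f = 0}"
    unfolding dd_ideal_def
    by (rule ring.genideal_minimal[OF ring_free_algebra ideal_free_lift_kernel])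
  with assms(2) show ?thesis by auto
qed

text \<open>The point \<open>0\<close> stands for the monomial \<open>1\<close>. In a sorted word
  each letter meets a monomial without letters in earlier rows, so \<open>act_row_action\<close>
  raises one exponent at a time.\<close>

lemma act_prod_list_row_action:
  assumes "sorted_wrt le_lex w" "set w \<subseteq> dd_index n"
  shows "act (prod_list (map (\<lambda>(i, j). row_action q n n i j) w)) F (\<lambda>p. 0) = F (\<lambda>p. int (count_list w p))"
  using assms
proof (induction w arbitrary: F)
  case Nil
  then show ?case by (simp add: act_simps)
next
  case (Cons x w)
  obtain i j where x: "x = (i, j)" by (cases x)
  have "act (row_action q n n i j) F (\<lambda>p. int (count_list w p))
      = F (\<lambda>p. int (count_list w p) + unit_exp (i, j) p)"
    using Cons.prems by (intro act_row_action) (fastforce simp: x le_lex_def count_list_0_iff)+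
  also have "(\<lambda>p. int (count_list w p) + unit_exp (i, j) p) = (\<lambda>p. int (count_list (x # w) p))"
    by (auto simp: x fun_eq_iff)
  finally show ?case
    using Cons by (simp add: act_simps x)
qed

section \<open>The basis of ordered monomials\<close>

abbreviation dd_coset ::
    "'k::field \<Rightarrow> nat \<Rightarrow> ((nat \<times> nat) free_monoid \<Rightarrow>\<^sub>0 'k) \<Rightarrow> ((nat \<times> nat) free_monoid \<Rightarrow>\<^sub>0 'k) set" where
  "dd_coset q n f \<equiv> dd_ideal q n +>\<^bsub>free_algebra (dd_index n) :: ('k, _) module\<^esub> f"

abbreviation monom_word :: "'x list \<Rightarrow> 'x free_monoid \<Rightarrow>\<^sub>0 'k::field" where
  "monom_word w \<equiv> Poly_Mapping.single (Word w) 1"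

lemma monom_word_append: "monom_word (v @ w) = monom_word v * monom_word w"
  by (simp add: mult_single plus_free_monoid_def)

lemma monom_word_Nil: "monom_word [] = 1"
  by (simp add: zero_free_monoid_def[symmetric])

lemma act_scalar_mult: "act (scalar_op c * T) F s = c * act T F s"
  by transfer simp

lemma monom_word_closed: "set w \<subseteq> X \<Longrightarrow> monom_word w \<in> carrier (free_algebra X)"
  by (simp add: free_algebra_carrier)

context
  fixes q :: "'k::field" and n :: nat
begin

declare One_nat_def [simp del] upt_Suc [simp del]

interpretation I: ideal "dd_ideal q n" "free_algebra (dd_index n) :: ('k, _) module"
  by (rule ideal_dd_ideal)

lemma carrier_dd_algebra:
  "carrier (dd_algebra q n) = dd_coset q n ` carrier (free_algebra (dd_index n))"
  by (auto simp: dd_algebra_def quotient_algebra_simps FactRing_simps)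

lemma dd_coset_mult:
  "f \<in> carrier (free_algebra (dd_index n)) \<Longrightarrow> g \<in> carrier (free_algebra (dd_index n)) \<Longrightarrow>
     dd_coset q n f \<otimes>\<^bsub>dd_algebra q n\<^esub> dd_coset q n g = dd_coset q n (f * g)"
  using I.rcoset_mult_add[of f g]
  by (simp add: dd_algebra_def quotient_algebra_simps FactRing_def free_algebra_simps)

lemma dd_coset_add:
  "f \<in> carrier (free_algebra (dd_index n)) \<Longrightarrow> g \<in> carrier (free_algebra (dd_index n)) \<Longrightarrow>
     dd_coset q n f \<oplus>\<^bsub>dd_algebra q n\<^esub> dd_coset q n g = dd_coset q n (f + g)"
  using I.a_rcos_sum[of f g]
  by (simp add: dd_algebra_def quotient_algebra_simps FactRing_def free_algebra_simps)

lemma dd_coset_smult: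
  "f \<in> carrier (free_algebra (dd_index n)) \<Longrightarrow>
     c \<odot>\<^bsub>dd_algebra q n\<^esub> dd_coset q n f = dd_coset q n (Poly_Mapping.single 0 c * f)"
  unfolding dd_algebra_def by (rule smult_coset[OF ideal_dd_ideal])

lemma dd_coset_one: "\<one>\<^bsub>dd_algebra q n\<^esub> = dd_coset q n 1"
  by (simp add: dd_algebra_def quotient_algebra_simps FactRing_def free_algebra_simps)

lemma dd_coset_zero: "\<zero>\<^bsub>dd_algebra q n\<^esub> = dd_coset q n 0"
  using I.a_coset_add_zero[OF I.a_subset]
  by (simp add: dd_algebra_def quotient_algebra_simps FactRing_def free_algebra_simps)

lemma dd_coset_eqI:
  assumes "g \<in> carrier (free_algebra (dd_index n))" "f - g \<in> dd_ideal q n"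
  shows "dd_coset q n f = dd_coset q n g"
proof -
  have "f \<in> dd_coset q n g"
    using assms(2) by (auto simp: a_r_coset_def' free_algebra_simps intro!: bexI[of _ "f - g"])
  then show ?thesis
    by (rule I.a_repr_independence'[OF _ assms(1), symmetric])
qed

lemma dd_coset_power:
  assumes "f \<in> carrier (free_algebra (dd_index n))"
  shows "dd_coset q n f [^]\<^bsub>dd_algebra q n\<^esub> (m::nat) = dd_coset q n (f ^ m)
    \<and> f ^ m \<in> carrier (free_algebra (dd_index n))"
proof (induction m)
  case 0
  then show ?case by (simp add: nat_pow_def dd_coset_one free_algebra_closed)
next
  case (Suc m)
  then show ?case
    using assms
    by (simp add: nat_pow_def dd_coset_mult free_algebra_closed power_Suc2 del: power_Suc)
qed

text \<open>Reduces computations with ordered monomials to single words of the free algebra.\<close>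

lemma dd_monomial_eq:
  "dd_monomial q n k = dd_coset q n (monom_word (power_word (dd_letters n) k))"
proof -
  have gen_power: "free_gen x ^ m = (monom_word (replicate m x) :: (nat \<times> nat) free_monoid \<Rightarrow>\<^sub>0 'k)" for x m
    by (induction m) (simp_all add: monom_word_Nil free_gen_def flip: monom_word_append)
  have "foldr (\<lambda>x m. (dd_gen q n x [^]\<^bsub>dd_algebra q n\<^esub> k x) \<otimes>\<^bsub>dd_algebra q n\<^esub> m) xs \<one>\<^bsub>dd_algebra q n\<^esub>
      = dd_coset q n (monom_word (power_word xs k))" if "set xs \<subseteq> dd_index n" for xs
    using that
  proof (induction xs)
    case Nil
    then show ?case by (simp add: dd_coset_one monom_word_Nil)
  next
    case (Cons x xs)
    have "free_gen x \<in> carrier (free_algebra (dd_index n) :: ('k, _) module)"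
      using Cons.prems by (intro free_algebra_gen_closed) auto
    note power = dd_coset_power[OF this, of "k x", unfolded gen_power]
    have "monom_word (power_word xs k) \<in> carrier (free_algebra (dd_index n) :: ('k, _) module)"
      using set_power_word_subset[of xs k] Cons.prems by (intro monom_word_closed) auto
    then show ?case
      using Cons power by (simp add: dd_gen_def dd_coset_mult monom_word_append)
  qed
  then show ?thesis
    unfolding dd_monomial_def by (simp add: set_dd_letters del: set_product)
qed

section \<open>Straightening of words and spanning\<close>

text \<open>The ideal is two-sided, so a relation may be applied inside a word.\<close>

lemma dd_relation_context:
  assumes "r \<in> dd_relations q n" "set u \<subseteq> dd_index n" "set v \<subseteq> dd_index n"
  shows "monom_word u * r * monom_word v \<in> dd_ideal q n"
proof -
  have "r \<in> dd_ideal q n"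
    using I.genideal_self[OF dd_relations_closed[of q n]] assms(1) by (auto simp: dd_ideal_def)
  then have "monom_word u * r \<in> dd_ideal q n"
    using I.I_l_closed[OF _ monom_word_closed[OF assms(2)]] by (simp add: free_algebra_simps)
  then show ?thesis
    using I.I_r_closed[OF _ monom_word_closed[OF assms(3)]] by (simp add: free_algebra_simps)
qed

text \<open>Each way in which two adjacent letters can be out of order is covered by exactly one
  kind of defining relation.\<close>

lemma dd_word_rewrite:
  assumes "set (u @ [(i, j), (s, t)] @ v) \<subseteq> dd_index n" "\<not> le_lex (i, j) (s, t)"
  obtains "i > s" "j \<le> t"
      "dd_coset q n (monom_word (u @ [(i, j), (s, t)] @ v))
         = dd_coset q n (Poly_Mapping.single 0 q * monom_word (u @ [(s, t), (i, j)] @ v))"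
    | "i > s" "j > t"
      "dd_coset q n (monom_word (u @ [(i, j), (s, t)] @ v))
         = dd_coset q n (monom_word (u @ [(s, t), (i, j)] @ v)
             + Poly_Mapping.single 0 (q - 1) * monom_word (u @ [(s, j), (i, t)] @ v))"
    | "i = s" "j > t"
      "dd_coset q n (monom_word (u @ [(i, j), (s, t)] @ v))
         = dd_coset q n (monom_word (u @ [(s, t), (i, j)] @ v))"
proof -
  let ?d = "\<lambda>x. free_gen x :: (nat \<times> nat) free_monoid \<Rightarrow>\<^sub>0 'k"
  have idx: "(i, j) \<in> dd_index n" "(s, t) \<in> dd_index n" "set u \<subseteq> dd_index n" "set v \<subseteq> dd_index n"
    using assms(1) by auto
  have word: "monom_word (u @ [x, y] @ v) = monom_word u * (?d x * ?d y) * monom_word v" for x y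
    by (simp add: free_gen_def mult_single plus_free_monoid_def)
  have scalar: "Poly_Mapping.single 0 c * (monom_word u * f * monom_word v)
      = monom_word u * (Poly_Mapping.single 0 c * f) * monom_word v"
    for c and f :: "(nat \<times> nat) free_monoid \<Rightarrow>\<^sub>0 'k"
  proof -
    have "Poly_Mapping.single 0 c * monom_word u = monom_word u * Poly_Mapping.single 0 c"
      by (simp add: mult_single)
    then show ?thesis by (simp only: mult.assoc[symmetric])
  qed
  have closed: "monom_word (u @ [x, y] @ v) \<in> carrier (free_algebra (dd_index n) :: ('k, _) module)"
    if "x \<in> dd_index n" "y \<in> dd_index n" for x y
    using that idx by (intro monom_word_closed) auto
  have rewrite: "dd_coset q n (monom_word (u @ [(i, j), (s, t)] @ v)) = dd_coset q n g"
    if "r \<in> dd_relations q n" "g \<in> carrier (free_algebra (dd_index n))"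
      "monom_word (u @ [(i, j), (s, t)] @ v) - g = monom_word u * r * monom_word v" for r g
    using dd_coset_eqI[OF that(2)] dd_relation_context[OF that(1) idx(3,4)] that(3) by simp
  consider "i > s" "j \<le> t" | "i > s" "j > t" | "i = s" "j > t"
    using assms(2) by (fastforce simp: le_lex_def)
  then show thesis
  proof cases
    case 1
    have mem: "?d (i, j) * ?d (s, t) - Poly_Mapping.single 0 q * (?d (s, t) * ?d (i, j)) \<in> dd_relations q n"
      using 1 idx unfolding dd_relations_def Let_def by blast
    show thesis
    proof (rule that(1)[OF 1 rewrite[OF mem]])
      show "Poly_Mapping.single 0 q * monom_word (u @ [(s, t), (i, j)] @ v) \<in> carrier (free_algebra (dd_index n))"
        by (intro free_algebra_closed closed idx)
    qed (simp only: word scalar, simp only: right_diff_distrib left_diff_distrib)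
  next
    case 2
    have mem: "?d (i, j) * ?d (s, t) - (?d (s, t) * ?d (i, j)
        + Poly_Mapping.single 0 (q - 1) * (?d (s, j) * ?d (i, t))) \<in> dd_relations q n"
      using 2 idx unfolding dd_relations_def Let_def by blast
    have idx': "(s, j) \<in> dd_index n" "(i, t) \<in> dd_index n"
      using idx by auto
    show thesis
    proof (rule that(2)[OF 2 rewrite[OF mem]])
      show "monom_word (u @ [(s, t), (i, j)] @ v)
          + Poly_Mapping.single 0 (q - 1) * monom_word (u @ [(s, j), (i, t)] @ v)
          \<in> carrier (free_algebra (dd_index n))"
        by (intro free_algebra_closed closed idx idx')
    qed (simp only: word scalar, simp only: right_diff_distrib left_diff_distrib distrib_left distrib_right)
  next
    case 3
    then have "(i, j) \<in> dd_index n" "(i, t) \<in> dd_index n"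
      using idx by auto
    then have mem: "?d (i, j) * ?d (s, t) - ?d (s, t) * ?d (i, j) \<in> dd_relations q n"
      using 3 unfolding dd_relations_def Let_def by blast
    show thesis
    proof (rule that(3)[OF 3 rewrite[OF mem]])
      show "monom_word (u @ [(s, t), (i, j)] @ v) \<in> carrier (free_algebra (dd_index n) :: ('k, _) module)"
        by (intro closed idx)
    qed (simp only: word, simp only: right_diff_distrib left_diff_distrib)
  qed
qed

interpretation V: vectorspace "class_ring :: 'k ring" "dd_algebra q n"
  by (rule vectorspace_dd_algebra)

lemma dd_monomial_closed: "dd_monomial q n k \<in> carrier (dd_algebra q n)"
  unfolding dd_monomial_eq carrier_dd_algebra
  by (intro imageI monom_word_closed order_trans[OF set_power_word_subset]) auto

text \<open>Exponent functions are extensional, so that different functions differ on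
  \<open>dd_index n\<close>.\<close>

abbreviation dd_basis :: "((nat \<times> nat) free_monoid \<Rightarrow>\<^sub>0 'k) set set" where
  "dd_basis \<equiv> dd_monomial q n ` (dd_index n \<rightarrow>\<^sub>E UNIV)"

text \<open>
  Straightening replaces a word by words of the same length that are smaller in the lexicographic
  order on words, which is well-founded on words of a fixed length.
\<close>

lemma dd_word_in_span:
  assumes "set w \<subseteq> dd_index n"
  shows "dd_coset q n (monom_word w) \<in> V.span dd_basis"
proof -
  have sub: "dd_basis \<subseteq> carrier (dd_algebra q n)"
    using dd_monomial_closed by auto
  have submod: "submodule (class_ring :: 'k ring) (V.span dd_basis) (dd_algebra q n)"
    by (rule V.span_is_submodule[OF sub])
  note add = submodule.m_closed[OF submod] and smult = submodule.smult_closed[OF submod]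
  have "wf (lex (less_than <*lex*> less_than))"
    by (intro wf_lex wf_lex_prod wf_less_than)
  then show ?thesis using assms
  proof (induction w rule: wf_induct_rule)
    case (less w)
    show ?case
    proof (cases "sorted_wrt le_lex w")
      case True
      \<comment> \<open>Restriction makes the multiplicities an extensional exponent function
        without changing the word.\<close>
      have "power_word (dd_letters n) (restrict (count_list w) (dd_index n))
          = power_word (dd_letters n) (count_list w)"
        by (rule power_word_cong) auto
      also have "\<dots> = w"
        using True less.prems sorted_dd_letters distinct_dd_letters
        by (intro power_word_count_list[where R = le_lex])
          (auto simp: set_dd_letters antisymp_def le_lex_def)
      finally have "dd_coset q n (monom_word w) \<in> dd_basis"
        by (intro image_eqI[where x = "restrict (count_list w) (dd_index n)"])
          (auto simp: dd_monomial_eq)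
      then show ?thesis
        using V.in_own_span[OF sub] by blast
    next
      case False
      then obtain u x y v where w: "w = u @ [x, y] @ v" "\<not> le_lex x y"
        by (rule unsorted_adjacent)
      obtain i j s t where xy: "x = (i, j)" "y = (s, t)"
        by (metis surj_pair)
      \<comment> \<open>Every rewriting puts a smaller letter in the place of \<open>x\<close>:
        either \<open>y\<close>, or \<open>(s, j)\<close> with \<open>s < i\<close>. The letter
        after it is therefore arbitrary.\<close>
      have IH: "dd_coset q n (monom_word (u @ [a, b] @ v)) \<in> V.span dd_basis"
        "monom_word (u @ [a, b] @ v) \<in> carrier (free_algebra (dd_index n) :: ('k, _) module)"
        if "(a, x) \<in> less_than <*lex*> less_than" "a \<in> dd_index n" "b \<in> dd_index n" for a b
      proof -
        have "(u @ [a, b] @ v, w) \<in> lex (less_than <*lex*> less_than)"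
          using that(1) by (simp add: w lex_append_leftI)
        then show "dd_coset q n (monom_word (u @ [a, b] @ v)) \<in> V.span dd_basis"
          by (rule less.IH) (use that less.prems w in auto)
        show "monom_word (u @ [a, b] @ v) \<in> carrier (free_algebra (dd_index n) :: ('k, _) module)"
          by (rule monom_word_closed) (use that less.prems w in auto)
      qed
      have idx: "(i, j) \<in> dd_index n" "(s, t) \<in> dd_index n" "(s, j) \<in> dd_index n" "(i, t) \<in> dd_index n"
        using less.prems by (auto simp: w xy)
      show ?thesis
      proof (rule dd_word_rewrite[of u i j s t v, folded xy, folded w(1)])
        show "set w \<subseteq> dd_index n" "\<not> le_lex x y"
          by (rule less.prems, rule w(2))
      next
        assume *: "s < i" "j \<le> t" "dd_coset q n (monom_word w) = dd_coset q n (Poly_Mapping.single 0 q * monom_word (u @ [y, x] @ v))"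
        then show ?thesis
          using IH[of y x] idx by (simp add: xy smult flip: dd_coset_smult)
      next
        assume *: "s < i" "t < j" "dd_coset q n (monom_word w) = dd_coset q n (monom_word (u @ [y, x] @ v)
             + Poly_Mapping.single 0 (q - 1) * monom_word (u @ [(s, j), (i, t)] @ v))"
        then show ?thesis
          using IH[of y x] IH[of "(s, j)" "(i, t)"] idx
          by (simp add: xy add smult free_algebra_closed flip: dd_coset_smult dd_coset_add)
      next
        assume *: "i = s" "t < j" "dd_coset q n (monom_word w) = dd_coset q n (monom_word (u @ [y, x] @ v))"
        then show ?thesis
          using IH[of y x] idx by (simp add: xy)
      qed
    qed
  qed
qed

lemma dd_basis_generates: "V.span dd_basis = carrier (dd_algebra q n)"
proof
  have sub: "dd_basis \<subseteq> carrier (dd_algebra q n)"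
    using dd_monomial_closed by auto
  then show "V.span dd_basis \<subseteq> carrier (dd_algebra q n)"
    by (rule V.span_is_subset2)
  have submod: "submodule (class_ring :: 'k ring) (V.span dd_basis) (dd_algebra q n)"
    by (rule V.span_is_submodule[OF sub])
  \<comment> \<open>Membership in the carrier is part of the induction because
    \<open>dd_coset_add\<close> requires it of both summands.\<close>
  have "f \<in> carrier (free_algebra (dd_index n)) \<and> dd_coset q n f \<in> V.span dd_basis"
    if f: "f \<in> carrier (free_algebra (dd_index n))" for f
  proof (induction f rule: poly_mapping_add_induct)
    case (1 w c)
    then have w: "set (letters w) \<subseteq> dd_index n"
      using f by (auto simp: free_algebra_carrier)
    note closed = monom_word_closed[OF this]
    have "Poly_Mapping.single w c = Poly_Mapping.single 0 c * monom_word (letters w)"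
      by (simp add: mult_single)
    moreover have "dd_coset q n (Poly_Mapping.single 0 c * monom_word (letters w)) \<in> V.span dd_basis"
      unfolding dd_coset_smult[OF closed, symmetric]
      by (rule submodule.smult_closed[OF submod _ dd_word_in_span[OF w]]) simp
    ultimately show ?case
      using free_algebra_mult_closed[OF free_algebra_const_closed closed] by metis
  next
    case 2
    then show ?case
      using submodule.zero_closed[OF submod] by (simp add: free_algebra_closed dd_coset_zero)
  next
    case (3 f g)
    then show ?case
      using submodule.m_closed[OF submod] by (simp add: free_algebra_closed flip: dd_coset_add)
  qed
  then show "carrier (dd_algebra q n) \<subseteq> V.span dd_basis"
    by (auto simp: carrier_dd_algebra)
qed

section \<open>Coefficient functionals and linear independence\<close>

text \<open>The coefficient of the ordered monomial \<open>k\<close> in the result of applying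
  \<open>f\<close> to \<open>1\<close>. The exponents are read from the word rather than from
  \<open>k\<close>, so that they are \<open>0\<close> outside \<open>dd_index n\<close>, where an
  extensional \<open>k\<close> is \<open>undefined\<close>.\<close>

definition dd_coeff ::
    "(nat \<times> nat \<Rightarrow> nat) \<Rightarrow> ((nat \<times> nat) free_monoid \<Rightarrow>\<^sub>0 'k) \<Rightarrow> 'k" where
  "dd_coeff k f = act (free_lift (\<lambda>(i, j). row_action q n n i j) f)
     (\<lambda>m. of_bool (m = (\<lambda>p. int (count_list (power_word (dd_letters n) k) p)))) (\<lambda>p. 0)"

definition dd_coset_coeff ::
    "(nat \<times> nat \<Rightarrow> nat) \<Rightarrow> ((nat \<times> nat) free_monoid \<Rightarrow>\<^sub>0 'k) set \<Rightarrow> 'k" where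
  "dd_coset_coeff k C = dd_coeff k (SOME f. f \<in> C)"

text \<open>The choice of representative is harmless: \<open>row_action\<close> satisfies the
  relations, so \<open>dd_coeff k\<close> vanishes on the ideal by which representatives
  differ.\<close>

lemma dd_coset_coeff:
  assumes "q \<noteq> 0" "f \<in> carrier (free_algebra (dd_index n))"
  shows "dd_coset_coeff k (dd_coset q n f) = dd_coeff k f"
proof -
  have "dd_rels (scalar_op q) {1..n} {1..n} (row_action q n n)"
    using dd_rels_row_action[OF assms(1), of n n] unfolding dd_rels_def by blast
  then have kernel: "dd_coeff k g = 0" if "g \<in> dd_ideal q n" for g
    using dd_ideal_free_lift[of q n "\<lambda>(i, j). row_action q n n i j" g] that
    by (simp add: dd_coeff_def act_simps)
  have "(SOME g. g \<in> dd_coset q n f) \<in> dd_coset q n f"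
    by (rule someI[of _ f]) (use I.a_rcos_self[OF assms(2)] in simp)
  then obtain h where "h \<in> dd_ideal q n" "(SOME g. g \<in> dd_coset q n f) = h + f"
    by (auto simp: a_r_coset_def' free_algebra_simps)
  then show ?thesis
    using kernel[of h] by (simp add: dd_coset_coeff_def dd_coeff_def free_lift_add act_simps)
qed

lemma dd_coset_coeff_add:
  assumes "q \<noteq> 0" "C \<in> carrier (dd_algebra q n)" "D \<in> carrier (dd_algebra q n)"
  shows "dd_coset_coeff k (C \<oplus>\<^bsub>dd_algebra q n\<^esub> D) = dd_coset_coeff k C + dd_coset_coeff k D"
  using assms(2,3)
  by (auto simp: carrier_dd_algebra dd_coset_add dd_coset_coeff[OF assms(1)] free_algebra_closed
      dd_coeff_def free_lift_add act_simps(3))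

lemma dd_coset_coeff_smult:
  assumes "q \<noteq> 0" "C \<in> carrier (dd_algebra q n)"
  shows "dd_coset_coeff k (c \<odot>\<^bsub>dd_algebra q n\<^esub> C) = c * dd_coset_coeff k C"
  using assms(2)
  by (auto simp: carrier_dd_algebra dd_coset_smult dd_coset_coeff[OF assms(1)] free_algebra_closed
      dd_coeff_def free_lift_mult free_lift_scalar act_scalar_mult)

text \<open>The functionals are dual to the ordered monomials, because a sorted word applied to
  \<open>1\<close> returns its own exponents.\<close>

lemma dd_coset_coeff_monomial:
  assumes "q \<noteq> 0" "k \<in> dd_index n \<rightarrow>\<^sub>E UNIV" "l \<in> dd_index n \<rightarrow>\<^sub>E UNIV"
  shows "dd_coset_coeff k (dd_monomial q n l) = of_bool (k = l)"
proof -
  let ?w = "power_word (dd_letters n)"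
  have letters: "set (?w l) \<subseteq> dd_index n"
    using set_power_word_subset[of "dd_letters n" l] unfolding set_dd_letters .
  have "sorted_wrt le_lex (?w l)"
    by (rule sorted_wrt_power_word[OF sorted_dd_letters]) (simp add: le_lex_def)
  then have "dd_coeff k (monom_word (?w l))
      = of_bool ((\<lambda>p. int (count_list (?w l) p)) = (\<lambda>p. int (count_list (?w k) p)))"
    using letters by (simp add: dd_coeff_def free_lift_single scalar_op_simps act_prod_list_row_action)
  also have "((\<lambda>p. int (count_list (?w l) p)) = (\<lambda>p. int (count_list (?w k) p))) \<longleftrightarrow> k = l"
  proof
    assume "(\<lambda>p. int (count_list (?w l) p)) = (\<lambda>p. int (count_list (?w k) p))"
    then have "count_list (?w l) p = count_list (?w k) p" for p
      by (cases p) (simp add: fun_eq_iff)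
    then have "k p = l p" if "p \<in> dd_index n" for p
      using that unfolding count_list_power_word[OF distinct_dd_letters] set_dd_letters
      by (metis (full_types))
    then show "k = l"
      by (rule PiE_ext[OF assms(2,3)])
  qed simp
  finally show ?thesis
    unfolding dd_monomial_eq dd_coset_coeff[OF assms(1) monom_word_closed[OF letters]] .
qed

lemma dd_coset_coeff_lincomb:
  assumes "q \<noteq> 0" "finite A" "A \<subseteq> carrier (dd_algebra q n)"
  shows "dd_coset_coeff k (V.lincomb a A) = (\<Sum>v\<in>A. a v * dd_coset_coeff k v)"
  using assms(2,3)
proof (induction A rule: finite_induct)
  case empty
  have "dd_coset_coeff k (dd_coset q n 0) = 0"
    by (simp add: dd_coset_coeff[OF assms(1)] free_algebra_closed dd_coeff_def free_lift_0 act_simps)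
  then show ?case
    by (simp add: V.lincomb_def dd_coset_zero)
next
  case (insert v A)
  then show ?case
    using V.lincomb_insert[of A a v] V.lincomb_closed[of A a]
    by (simp add: dd_coset_coeff_add[OF assms(1)] dd_coset_coeff_smult[OF assms(1)])
qed

end

theorem corollary2p2:
  fixes q :: "'k::field_char_0" and n :: nat
  assumes "q \<noteq> 0" and "n \<ge> 2"
  shows "inj_on (dd_monomial q n) (dd_index n \<rightarrow>\<^sub>E UNIV) \<and>
    vectorspace.basis (class_ring :: 'k ring) (dd_algebra q n)
      (dd_monomial q n ` (dd_index n \<rightarrow>\<^sub>E UNIV))"
proof
  let ?K = "dd_index n \<rightarrow>\<^sub>E (UNIV :: nat set)" and ?B = "dd_monomial q n ` (dd_index n \<rightarrow>\<^sub>E UNIV)"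
  interpret V: vectorspace "class_ring :: 'k ring" "dd_algebra q n"
    by (rule vectorspace_dd_algebra)
  note coeff = dd_coset_coeff_monomial[OF assms(1)]
  show inj: "inj_on (dd_monomial q n) ?K"
  proof (rule inj_onI)
    fix k l assume "k \<in> ?K" "l \<in> ?K" "dd_monomial q n k = dd_monomial q n l"
    then show "k = l"
      using coeff[of k n k] coeff[of k n l] by (simp split: if_splits)
  qed
  have carrier: "?B \<subseteq> carrier (dd_algebra q n)"
    using dd_monomial_closed by auto
  have "\<not> V.lin_dep ?B"
  proof
    assume "V.lin_dep ?B"
    then obtain A a v where A: "finite A" "A \<subseteq> ?B"
      "V.lincomb a A = \<zero>\<^bsub>dd_algebra q n\<^esub>" "v \<in> A" "a v \<noteq> (0 :: 'k)"
      unfolding V.lin_dep_def by auto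
    obtain k where k: "k \<in> ?K" "v = dd_monomial q n k"
      using A by auto
    \<comment> \<open>On \<open>A\<close> the functional of \<open>v\<close> is the indicator of
      \<open>v\<close>, so it extracts \<open>a v\<close> from the linear combination.\<close>
    have "dd_coset_coeff q n k w = of_bool (w = v)" if w: "w \<in> A" for w
    proof -
      obtain l where l: "l \<in> ?K" "w = dd_monomial q n l"
        using A(2) w by auto
      have "w = v \<longleftrightarrow> k = l"
        using inj_onD[OF inj _ k(1) l(1)] by (auto simp: k(2) l(2))
      then show ?thesis
        using coeff[OF k(1) l(1)] by (simp add: l(2))
    qed
    then have "(\<Sum>w\<in>A. a w * dd_coset_coeff q n k w) = (\<Sum>w\<in>A. if w = v then a w else 0)"
      by (intro sum.cong) auto
    also have "\<dots> = a v"
      using A by simp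
    finally have "dd_coset_coeff q n k (V.lincomb a A) = a v"
      using A carrier by (subst dd_coset_coeff_lincomb[OF assms(1)]) auto
    \<comment> \<open>The zero vector is treated as the empty linear combination, which gives the
      contradiction with \<open>a v\<close> being nonzero.\<close>
    moreover have "dd_coset_coeff q n k (V.lincomb a {}) = 0"
      by (subst dd_coset_coeff_lincomb[OF assms(1)]) auto
    ultimately show False
      using A by (simp add: V.lincomb_def)
  qed
  then show "V.basis ?B"
    unfolding V.basis_def using dd_basis_generates carrier by blast
qed

end
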